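(* Let $G$ and $H$ be arbitrary finite groups and let $d = lev_{\gamma,\theta}$ (with $\gamma,\theta>0$) be an arbitrary generalized Levenshtein distance. Then there is a regular language $L\subset\{0,1\}^*$ such that $Isom_d(L)\cong G\times H^{\mathbb{N}}$.
   Context: For a finite alphabet $A$, $A^*$ is the set of all finite words over $A$ (including the empty word), and a language is a subset of $A^*$. A regular language is a language that can be obtained from finite languages by finitely many applications of union, product $UV=\{uv \mid u\in U, v\in V\}$ and Kleene star $U^*=\bigcup_{n=0}^\infty U^n$. For real $\gamma,\theta>0$ the generalized Levenshtein distance with insertion (equivalently, removal) weight $\gamma$ and replacement weight $\theta$ is $$lev_{\gamma,\theta}(u,v)=\min\{\gamma n+\theta m \mid u \text{ can be transformed into } v \text{ by } n \text{ insertions or deletions of single characters and } m \text{ replacements of single characters}\}$$ where the intermediate words are arbitrary words of $A^*$. It is a metric on $A^*$. $Isom_d(L)$ is the group (under composition) of all bijections $\phi:L\to L$ with $d(\phi(u),\phi(v))=d(u,v)$ for all $u,v\in L$. $H^{\mathbb{N}}$ is the (unrestricted) Cartesian product of countably infinitely many copies of $H$. *)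

theory Defs
  imports Complex_Main "HOL-Algebra.Bij" "HOL-Algebra.Product_Groups"
begin

(* The alphabet A is a type 'a, so A^* is the whole type 'a list. *)

definition lang_prod :: "'a list set \<Rightarrow> 'a list set \<Rightarrow> 'a list set" where
  "lang_prod U V = {u @ v | u v. u \<in> U \<and> v \<in> V}"

primrec lang_pow :: "'a list set \<Rightarrow> nat \<Rightarrow> 'a list set" where
  "lang_pow U 0 = {[]}"
| "lang_pow U (Suc n) = lang_prod U (lang_pow U n)"

definition lang_star :: "'a list set \<Rightarrow> 'a list set" where
  "lang_star U = (\<Union>n. lang_pow U n)"

inductive regular_language :: "'a list set \<Rightarrow> bool" where
  finite_lang: "finite U \<Longrightarrow> regular_language U"
| union: "regular_language U \<Longrightarrow> regular_language V \<Longrightarrow> regular_language (U \<union> V)"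
| product: "regular_language U \<Longrightarrow> regular_language V \<Longrightarrow> regular_language (lang_prod U V)"
| star: "regular_language U \<Longrightarrow> regular_language (lang_star U)"

(* edits n m u v: u can be transformed into v by n insertions or deletions
   and m replacements, in any order.  Replacing a letter by itself is allowed;
   as the replacement weight is positive, this does not affect the minimum below. *)
inductive edits :: "nat \<Rightarrow> nat \<Rightarrow> 'a list \<Rightarrow> 'a list \<Rightarrow> bool" where
  edits_refl: "edits 0 0 u u"
| edits_insert: "edits n m u (x @ y) \<Longrightarrow> edits (Suc n) m u (x @ [a] @ y)"
| edits_delete: "edits n m u (x @ [a] @ y) \<Longrightarrow> edits (Suc n) m u (x @ y)"
| edits_replace: "edits n m u (x @ [a] @ y) \<Longrightarrow> edits n (Suc m) u (x @ [b] @ y)"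

definition lev :: "real \<Rightarrow> real \<Rightarrow> 'a list \<Rightarrow> 'a list \<Rightarrow> real" where
  "lev \<gamma> \<theta> u v = (LEAST r. \<exists>n m. r = \<gamma> * real n + \<theta> * real m \<and> edits n m u v)"

lemma edits_exist: "\<exists>n. edits n 0 u v"
proof -
  have del: "\<exists>n. edits n 0 u y" if "edits k 0 u (x @ y)" for k x and y :: "'a list"
    using that
  proof (induction x arbitrary: k)
    case (Cons a x)
    from Cons.prems have "edits k 0 u ([] @ [a] @ (x @ y))" by simp
    from edits_delete[OF this] show ?case using Cons.IH by auto
  qed auto
  have "edits 0 0 u (u @ [])" by (simp add: edits_refl)
  from del[OF this] obtain k where k: "edits k 0 u []" by blast
  show ?thesis
  proof (induction v)
    case Nil
    then show ?case using k by blast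
  next
    case (Cons a v)
    then obtain n where "edits n 0 u ([] @ v)" by auto
    from edits_insert[OF this, of a] show ?case by auto
  qed
qed

(* The minimum in the definition of lev exists. *)
lemma
  assumes "\<gamma> > 0" "\<theta> > 0"
  shows lev_attained: "\<exists>n m. lev \<gamma> \<theta> u v = \<gamma> * real n + \<theta> * real m \<and> edits n m u v"
    and lev_le: "edits n m u v \<Longrightarrow> lev \<gamma> \<theta> u v \<le> \<gamma> * real n + \<theta> * real m"
proof -
  define P where "P r \<longleftrightarrow> (\<exists>n m. r = \<gamma> * real n + \<theta> * real m \<and> edits n m u v)" for r
  obtain k where k: "edits k 0 u v" using edits_exist by blast
  define c where "c = \<gamma> * real k"
  have Pc: "P c" unfolding P_def c_def using k by (intro exI[of _ k] exI[of _ 0]) simp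
  have "{r. P r \<and> r \<le> c} \<subseteq> (\<lambda>(n, m). \<gamma> * real n + \<theta> * real m) `
      ({..nat \<lceil>c / \<gamma>\<rceil>} \<times> {..nat \<lceil>c / \<theta>\<rceil>})"
  proof
    fix r assume "r \<in> {r. P r \<and> r \<le> c}"
    then obtain n m where r: "r = \<gamma> * real n + \<theta> * real m" "r \<le> c"
      unfolding P_def by blast
    have "0 \<le> \<gamma> * real n" "0 \<le> \<theta> * real m" using assms by simp_all
    then have "\<gamma> * real n \<le> c" "\<theta> * real m \<le> c" using r by linarith+
    then have "real n \<le> c / \<gamma>" "real m \<le> c / \<theta>" using assms by (simp_all add: field_simps)
    then have "n \<le> nat \<lceil>c / \<gamma>\<rceil>" "m \<le> nat \<lceil>c / \<theta>\<rceil>" by linarith+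
    then show "r \<in> (\<lambda>(n, m). \<gamma> * real n + \<theta> * real m) `
      ({..nat \<lceil>c / \<gamma>\<rceil>} \<times> {..nat \<lceil>c / \<theta>\<rceil>})" using r by force
  qed
  then have fin: "finite {r. P r \<and> r \<le> c}" by (rule finite_subset) simp
  define r0 where "r0 = Min {r. P r \<and> r \<le> c}"
  have "r0 \<in> {r. P r \<and> r \<le> c}" unfolding r0_def using fin Pc by (intro Min_in) auto
  then have r0: "P r0" "r0 \<le> c" by auto
  have least: "r0 \<le> r" if "P r" for r
  proof (cases "r \<le> c")
    case True
    then show ?thesis unfolding r0_def using fin that by (intro Min_le) auto
  qed (use r0 in linarith)
  have "lev \<gamma> \<theta> u v = (LEAST r. P r)" unfolding lev_def P_def ..
  also have "\<dots> = r0" using r0 least by (intro Least_equality) auto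
  finally have eq: "lev \<gamma> \<theta> u v = r0" .
  show "\<exists>n m. lev \<gamma> \<theta> u v = \<gamma> * real n + \<theta> * real m \<and> edits n m u v"
    using r0 eq unfolding P_def by simp
  show "lev \<gamma> \<theta> u v \<le> \<gamma> * real n + \<theta> * real m" if "edits n m u v"
    unfolding eq using that by (intro least) (auto simp: P_def)
qed

(* As in Bij, the maps are taken extensional on L, so that each bijection of L
   is represented by exactly one function. *)
definition isom_group :: "('a \<Rightarrow> 'a \<Rightarrow> real) \<Rightarrow> 'a set \<Rightarrow> ('a \<Rightarrow> 'a) monoid" where
  "isom_group d L =
     BijGroup L \<lparr>carrier := {\<phi> \<in> Bij L. \<forall>u\<in>L. \<forall>v\<in>L. d (\<phi> u) (\<phi> v) = d u v}\<rparr>"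

lemma group_isom_group: "group (isom_group d L)"
proof -
  interpret B: group "BijGroup L" by (rule group_BijGroup)
  let ?I = "{\<phi> \<in> Bij L. \<forall>u\<in>L. \<forall>v\<in>L. d (\<phi> u) (\<phi> v) = d u v}"
  have mem: "f x \<in> L" if "f \<in> Bij L" "x \<in> L" for f x
    using Bij_imp_funcset[OF that(1)] that(2) by auto
  have "subgroup ?I (BijGroup L)"
  proof (rule B.subgroupI)
    show "?I \<subseteq> carrier (BijGroup L)" by (auto simp: BijGroup_def)
    show "?I \<noteq> {}" using id_Bij[of L] by force
  next
    fix f assume f: "f \<in> ?I"
    then have "inv\<^bsub>BijGroup L\<^esub> f = (\<lambda>x\<in>L. inv_into L f x)" by (simp add: inv_BijGroup)
    moreover have "d (inv_into L f u) (inv_into L f v) = d u v" if "u \<in> L" "v \<in> L" for u v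
    proof -
      have L: "inv_into L f u \<in> L" "inv_into L f v \<in> L" using f that Bij_inv_into_mem by auto
      have "f ` L = L" using f by (auto simp: Bij_def bij_betw_def)
      then have "f (inv_into L f u) = u" "f (inv_into L f v) = v"
        using that by (auto intro: f_inv_into_f)
      then show ?thesis using f L by force
    qed
    ultimately show "inv\<^bsub>BijGroup L\<^esub> f \<in> ?I" using f restrict_inv_into_Bij by auto
  next
    fix f g assume "f \<in> ?I" "g \<in> ?I"
    then show "f \<otimes>\<^bsub>BijGroup L\<^esub> g \<in> ?I"
      using compose_Bij[of f L g] mem by (auto simp: BijGroup_def compose_eq)
  qed
  then show ?thesis unfolding isom_group_def by (rule B.subgroup_imp_group)
qed

end

theory Submission
  imports Defs "HOL-Library.Sublist"
begin

text \<open>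
  A finite group \<open>H\<close> is the isometry group of a finite set of integer vectors with the
  \<open>l1\<close> distance, and such vectors can be written as the run lengths of binary words whose
  runs are all so long that no optimal edit sequence removes a run; then the edit distance is
  \<open>min \<theta> (2\<gamma>)\<close> times the \<open>l1\<close> distance, also after appending a common padding
  \<open>P\<^sup>k\<close> with \<open>P = (1\<^sup>r0\<^sup>r)\<^sup>j\<close>.  For word sets \<open>V\<close> and \<open>W\<close>
  realizing \<open>G\<close> and \<open>H\<close> take \<open>L = V \<union> W P P\<^sup>*\<close>.  The padding is so rich
  that every word of \<open>L\<close> is a subsequence of every longer one, so the distance between words of
  different lengths is \<open>\<gamma>\<close> times the difference of the lengths; it exceeds all distances between
  words of equal length.  Hence isometries preserve the length, and conversely isometries of the
  length classes \<open>V\<close>, \<open>W P\<close>, \<open>W P\<^sup>2\<close>, and so on, can be combined arbitrarily.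
\<close>

section \<open>Edit distance of words with long runs\<close>

lemma edits_trans:
  assumes "edits n' m' v w" "edits n m u v"
  shows "edits (n + n') (m + m') u w"
  using assms
proof (induction rule: edits.induct)
  case edits_refl
  then show ?case by simp
next
  case edits_insert
  then show ?case unfolding add_Suc_right by (blast intro: edits.edits_insert)
next
  case edits_delete
  then show ?case unfolding add_Suc_right by (blast intro: edits.edits_delete)
next
  case edits_replace
  then show ?case unfolding add_Suc_right by (blast intro: edits.edits_replace)
qed

lemma edits_context: "edits n m u v \<Longrightarrow> edits n m (x @ u @ y) (x @ v @ y)"
proof (induction rule: edits.induct)
  case (edits_refl u)
  show ?case by (rule edits.edits_refl)
next
  case (edits_insert n m u p q a)
  then show ?case using edits.edits_insert[of n m "x @ u @ y" "x @ p" "q @ y" a] by simp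
next
  case (edits_delete n m u p a q)
  then show ?case using edits.edits_delete[of n m "x @ u @ y" "x @ p" a "q @ y"] by simp
next
  case (edits_replace n m u p a q b)
  then show ?case using edits.edits_replace[of n m "x @ u @ y" "x @ p" a "q @ y" b] by simp
qed

lemma edits_append:
  assumes "edits n m u v" "edits n' m' u' v'"
  shows "edits (n + n') (m + m') (u @ u') (v @ v')"
proof (rule edits_trans)
  show "edits n m (u @ u') (v @ u')" using edits_context[OF assms(1), of "[]" u'] by simp
  show "edits n' m' (v @ u') (v @ v')" using edits_context[OF assms(2), of v "[]"] by simp
qed

lemma edits_subseq: "subseq u v \<Longrightarrow> edits (length v - length u) 0 u v"
proof (induction rule: list_emb.induct)
  case (list_emb_Nil v)
  show ?case
  proof (induction v)
    case (Cons a v)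
    then show ?case using edits_insert[of "length v" 0 "[]" "[]" v a] by simp
  qed (simp add: edits_refl)
next
  case (list_emb_Cons u v a)
  moreover have "length u \<le> length v"
    using list_emb_Cons by (simp add: list_emb_length)
  ultimately show ?case
    using edits_insert[of _ 0 u "[]" v a] by (simp add: Suc_diff_le)
next
  case (list_emb_Cons2 a b u v)
  then show ?case
    using edits_context[of _ 0 u v "[a]" "[]"] by simp
qed

text \<open>The relation \<open>edits\<close> is directed, so the counterpart for deletions has an
  induction of its own.\<close>

lemma edits_supseq: "subseq u v \<Longrightarrow> edits (length v - length u) 0 v u"
proof (induction rule: list_emb.induct)
  case (list_emb_Nil v)
  show ?case
  proof (induction v)
    case (Cons a v)
    from edits_context[OF this, of "[a]" "[]"] show ?case
      using edits_delete[of "length v" 0 "a # v" "[]" a "[]"] by simp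
  qed (simp add: edits_refl)
next
  case (list_emb_Cons u v a)
  moreover have "length u \<le> length v"
    using list_emb_Cons by (simp add: list_emb_length)
  moreover have "edits 1 0 (a # v) v"
    using edits_delete[OF edits_refl[of "[] @ [a] @ v"]] by simp
  ultimately show ?case
    using edits_trans[of "length v - length u" 0 v u 1 0 "a # v"] by (simp add: Suc_diff_le)
next
  case (list_emb_Cons2 a b u v)
  then show ?case
    using edits_context[of _ 0 v u "[a]" "[]"] by simp
qed

lemma edits_length: "edits n m u v \<Longrightarrow> length u \<le> length v + n \<and> length v \<le> length u + n"
  by (induction rule: edits.induct) auto

lemma subseq_delete_letter:
  assumes "subseq w (x @ [a] @ y)"
  obtains w' where "subseq w' w" "subseq w' (x @ y)" "length w \<le> Suc (length w')"
proof -
  obtain w1 w2 w3 where w: "w = w1 @ w2 @ w3" "subseq w1 x" "subseq w2 [a]" "subseq w3 y"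
    using assms by (metis subseq_appendE)
  have "subseq (w1 @ w3) w" unfolding w(1) by (intro list_emb_append_mono list_emb_append2) simp_all
  moreover have "subseq (w1 @ w3) (x @ y)" using w by (simp add: list_emb_append_mono)
  moreover have "length w2 \<le> 1" using list_emb_length[OF w(3)] by simp
  then have "length w \<le> Suc (length (w1 @ w3))" using w by simp
  ultimately show ?thesis using that by blast
qed

text \<open>A common subsequence of \<open>u\<close> and the current word is carried along. An
  insertion leaves it intact; a deletion or a replacement costs it at most one letter, that is 2 in
  \<open>2 * length w\<close>. For a deletion one of these 2 is offset by the shorter current
  word.\<close>

lemma edits_common_subseq:
  assumes "edits n m u v"
  shows "\<exists>w. subseq w u \<and> subseq w v \<and> length u + length v \<le> 2 * length w + n + 2 * m"
  using assms
proof (induction rule: edits.induct)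
  case (edits_refl u)
  show ?case by (rule exI[of _ u]) simp
next
  case (edits_insert n m u x y a)
  then obtain w where w: "subseq w u" "subseq w (x @ y)"
    "length u + length (x @ y) \<le> 2 * length w + n + 2 * m" by blast
  have "subseq (x @ y) (x @ [a] @ y)" by (intro list_emb_append_mono list_emb_append2) simp_all
  with w have "subseq w (x @ [a] @ y)" using subseq_order.order_trans by blast
  with w show ?case by (intro exI[of _ w]) simp
next
  case (edits_delete n m u x a y)
  then obtain w where w: "subseq w u" "subseq w (x @ [a] @ y)"
    "length u + length (x @ [a] @ y) \<le> 2 * length w + n + 2 * m" by blast
  from w(2) obtain w' where w': "subseq w' w" "subseq w' (x @ y)" "length w \<le> Suc (length w')"
    by (rule subseq_delete_letter)
  then have "subseq w' u" using w subseq_order.order_trans by blast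
  with w w' show ?case by (intro exI[of _ w']) simp
next
  case (edits_replace n m u x a y b)
  then obtain w where w: "subseq w u" "subseq w (x @ [a] @ y)"
    "length u + length (x @ [a] @ y) \<le> 2 * length w + n + 2 * m" by blast
  from w(2) obtain w' where w': "subseq w' w" "subseq w' (x @ y)" "length w \<le> Suc (length w')"
    by (rule subseq_delete_letter)
  then have "subseq w' u" using w subseq_order.order_trans by blast
  moreover have "subseq (x @ y) (x @ [b] @ y)" by (intro list_emb_append_mono list_emb_append2) simp_all
  with w' have "subseq w' (x @ [b] @ y)" using subseq_order.order_trans by blast
  ultimately show ?case using w w' by (intro exI[of _ w']) simp
qed

lemma lev_ge_length_diff:
  assumes "\<gamma> > 0" "\<theta> > 0"
  shows "\<gamma> * \<bar>real (length u) - real (length v)\<bar> \<le> lev \<gamma> \<theta> u v"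
proof -
  obtain n m where nm: "lev \<gamma> \<theta> u v = \<gamma> * real n + \<theta> * real m" "edits n m u v"
    using lev_attained[OF assms] by blast
  have "\<bar>real (length u) - real (length v)\<bar> \<le> real n"
    using edits_length[OF nm(2)] by linarith
  then have "\<gamma> * \<bar>real (length u) - real (length v)\<bar> \<le> \<gamma> * real n" using assms by simp
  moreover have "0 \<le> \<theta> * real m" using assms by simp
  ultimately show ?thesis using nm by linarith
qed

text \<open>Inserting or deleting just the surplus letters attains the bound of
  \<open>lev_ge_length_diff\<close>.\<close>

lemma lev_subseq:
  assumes "\<gamma> > 0" "\<theta> > 0" "subseq u v"
  shows "lev \<gamma> \<theta> u v = \<gamma> * \<bar>real (length u) - real (length v)\<bar>"
    and "lev \<gamma> \<theta> v u = \<gamma> * \<bar>real (length v) - real (length u)\<bar>"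
proof -
  have "length u \<le> length v" using assms(3) by (rule list_emb_length)
  then show "lev \<gamma> \<theta> u v = \<gamma> * \<bar>real (length u) - real (length v)\<bar>"
    "lev \<gamma> \<theta> v u = \<gamma> * \<bar>real (length v) - real (length u)\<bar>"
    using lev_le[OF assms(1,2) edits_subseq[OF assms(3)]]
      lev_le[OF assms(1,2) edits_supseq[OF assms(3)]]
      lev_ge_length_diff[OF assms(1,2), of u v] lev_ge_length_diff[OF assms(1,2), of v u]
    by (simp_all add: of_nat_diff)
qed

text \<open>For equal lengths \<open>edits_common_subseq\<close> gives
  \<open>k \<le> n / 2 + m\<close>: each letter missing from the common subsequence is paid for by
  two insertions or deletions or by one replacement, and the cheaper price is
  \<open>min \<theta> (2 * \<gamma>)\<close>.\<close>

lemma lev_ge_common_subseq: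
  assumes pos: "\<gamma> > 0" "\<theta> > 0" and len: "length u = length v"
    and lcs: "\<And>w. subseq w u \<Longrightarrow> subseq w v \<Longrightarrow> length w + k \<le> length u"
  shows "min \<theta> (2 * \<gamma>) * real k \<le> lev \<gamma> \<theta> u v"
proof -
  let ?c = "min \<theta> (2 * \<gamma>)"
  obtain n m where nm: "lev \<gamma> \<theta> u v = \<gamma> * real n + \<theta> * real m" "edits n m u v"
    using lev_attained[OF pos] by blast
  obtain w where "subseq w u" "subseq w v" "length u + length v \<le> 2 * length w + n + 2 * m"
    using edits_common_subseq[OF nm(2)] by blast
  with lcs len have "2 * k \<le> n + 2 * m" by fastforce
  then have "real k \<le> real n / 2 + real m" by linarith
  then have "?c * real k \<le> ?c * (real n / 2 + real m)"
    using pos by (intro mult_left_mono) auto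
  also have "\<dots> = (?c / 2) * real n + ?c * real m" by (simp add: algebra_simps)
  also have "\<dots> \<le> \<gamma> * real n + \<theta> * real m"
    by (intro add_mono mult_right_mono) auto
  finally show ?thesis using nm by simp
qed

section \<open>Binary words with prescribed run lengths\<close>

definition block :: "nat \<times> nat \<Rightarrow> bool list" where
  "block p = replicate (fst p) True @ replicate (snd p) False"

definition blocks :: "(nat \<times> nat) list \<Rightarrow> bool list" where
  "blocks ps = concat (map block ps)"

lemma blocks_simps [simp]:
  "blocks [] = []"
  "blocks (p # ps) = block p @ blocks ps"
  "blocks (ps @ qs) = blocks ps @ blocks qs"
  by (simp_all add: blocks_def)

lemma length_block [simp]: "length (block p) = fst p + snd p"
  by (simp add: block_def)

lemma length_blocks: "length (blocks ps) = (\<Sum>p\<leftarrow>ps. fst p + snd p)"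
  by (induction ps) auto

lemma subseq_replicate: "subseq w (replicate n a) \<Longrightarrow> \<exists>k\<le>n. w = replicate k a"
proof (induction n arbitrary: w)
  case (Suc n)
  show ?case
  proof (cases w)
    case (Cons b v)
    show ?thesis
    proof (cases "b = a")
      case True
      with Suc.prems Cons have "subseq v (replicate n a)" by simp
      then obtain k where "k \<le> n" "v = replicate k a" using Suc.IH by blast
      with True Cons show ?thesis by (intro exI[of _ "Suc k"]) simp
    next
      case False
      with Suc.prems Cons have "subseq w (replicate n a)" by simp
      then show ?thesis using Suc.IH le_SucI by blast
    qed
  qed auto
qed auto

text \<open>A subsequence of \<^term>\<open>blocks ps\<close> that misses fewer letters than the shortest run meets
  every run, so it has the same block structure.\<close>

lemma subseq_blocks:
  assumes "subseq w (blocks ps)" "\<forall>p\<in>set ps. M \<le> fst p \<and> M \<le> snd p"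
    "length (blocks ps) < length w + M"
  shows "\<exists>cs. w = blocks cs \<and>
    list_all2 (\<lambda>c p. 0 < fst c \<and> 0 < snd c \<and> fst c \<le> fst p \<and> snd c \<le> snd p) cs ps"
  using assms
proof (induction ps arbitrary: w)
  case (Cons p ps)
  from Cons.prems(1) obtain w1 w2 w3 where w: "w = w1 @ w2 @ w3"
    "subseq w1 (replicate (fst p) True)" "subseq w2 (replicate (snd p) False)"
    "subseq w3 (blocks ps)"
    unfolding blocks_simps block_def append_assoc by (metis subseq_appendE)
  obtain i j where ij: "i \<le> fst p" "w1 = replicate i True" "j \<le> snd p" "w2 = replicate j False"
    using w(2,3) subseq_replicate by metis
  have le: "length w3 \<le> length (blocks ps)" using w(4) by (rule list_emb_length)
  have lt: "fst p + snd p + length (blocks ps) < i + j + length w3 + M"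
    using Cons.prems(3) w ij by simp
  have M: "M \<le> fst p" "M \<le> snd p" using Cons.prems(2) by auto
  have "length (blocks ps) < length w3 + M" using lt ij by linarith
  then obtain cs where cs: "w3 = blocks cs"
    "list_all2 (\<lambda>c p. 0 < fst c \<and> 0 < snd c \<and> fst c \<le> fst p \<and> snd c \<le> snd p) cs ps"
    using Cons.IH[OF w(4)] Cons.prems(2) by auto
  \<comment> \<open>A vanished run alone would account for at least \<open>M\<close> missing
    letters, contrary to \<open>lt\<close>.\<close>
  have "0 < i" "0 < j" using lt le ij M by linarith+
  then show ?case
    using w ij cs by (intro exI[of _ "(i, j) # cs"]) (simp add: block_def)
qed (intro exI[of _ "[]"], simp)

text \<open>The condition with \<open>take 1\<close> says that the word does not begin with
  \<open>a\<close>, the empty word included. The leading run of \<open>a\<close> is then maximal, so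
  the whole word determines its length.\<close>

lemma replicate_append_eq_iff:
  assumes "a \<notin> set (take 1 u)" "a \<notin> set (take 1 v)"
  shows "replicate i a @ u = replicate j a @ v \<longleftrightarrow> i = j \<and> u = v"
proof (induction i arbitrary: j)
  case 0
  show ?case
  proof (cases j)
    case (Suc i)
    have "u \<noteq> a # replicate i a @ v"
    proof
      assume "u = a # replicate i a @ v"
      with assms(1) show False by simp
    qed
    then show ?thesis using Suc by simp
  qed simp
next
  case (Suc i)
  show ?case
  proof (cases j)
    case 0
    have "a # replicate i a @ u \<noteq> v"
    proof
      assume "a # replicate i a @ u = v"
      with assms(2) show False by auto
    qed
    then show ?thesis using 0 by simp
  next
    case (Suc j')
    then show ?thesis using Suc.IH[of j'] by simp
  qed
qed

lemma blocks_inject: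
  assumes "blocks cs = blocks ds"
    "\<forall>c\<in>set cs. 0 < fst c \<and> 0 < snd c" "\<forall>c\<in>set ds. 0 < fst c \<and> 0 < snd c"
  shows "cs = ds"
  using assms
proof (induction cs arbitrary: ds)
  case Nil
  then show ?case by (cases ds) (auto simp: block_def)
next
  case (Cons c cs)
  have take: "take 1 (replicate i a @ u) = [a]" if "0 < i" for i and a :: bool and u
    using that by (cases i) auto
  \<comment> \<open>A run of \<open>False\<close> is followed by the end of the word or by the
    \<open>True\<close> of the next block, so it is maximal as well.\<close>
  have F: "False \<notin> set (take 1 (blocks es))" if "\<forall>c\<in>set es. 0 < fst c \<and> 0 < snd c" for es
    using that take by (cases es) (simp_all add: block_def)
  show ?case
  proof (cases ds)
    case Nil
    then show ?thesis using Cons.prems by (simp add: block_def)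
  next
    case (Cons d ds')
    have pos: "0 < snd c" "0 < snd d" "\<forall>c\<in>set cs. 0 < fst c \<and> 0 < snd c"
      "\<forall>c\<in>set ds'. 0 < fst c \<and> 0 < snd c"
      using Cons.prems(2,3) Cons by auto
    have "replicate (fst c) True @ replicate (snd c) False @ blocks cs =
        replicate (fst d) True @ replicate (snd d) False @ blocks ds'"
      using Cons.prems(1) Cons by (simp add: block_def)
    then have "fst c = fst d \<and>
        replicate (snd c) False @ blocks cs = replicate (snd d) False @ blocks ds'"
      using pos take by (subst (asm) replicate_append_eq_iff) simp_all
    moreover from this have "snd c = snd d \<and> blocks cs = blocks ds'"
      using replicate_append_eq_iff[OF F[OF pos(3)] F[OF pos(4)]] by blast
    ultimately show ?thesis
      using Cons.IH[of ds'] pos Cons by (simp add: prod_eq_iff)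
  qed
qed

section \<open>Words coding integer vectors\<close>

text \<open>A coordinate \<open>x k \<le> T\<close> is coded by the place of one boundary inside a
  block of fixed length \<open>2 * M + T\<close>. Hence all words have the same length, while every
  run has length at least \<open>M\<close>.\<close>

definition vec_word :: "nat \<Rightarrow> nat \<Rightarrow> 'k list \<Rightarrow> ('k \<Rightarrow> nat) \<Rightarrow> bool list" where
  "vec_word M T ks x = blocks (map (\<lambda>k. (M + x k, M + (T - x k))) ks)"

definition padding :: "nat \<Rightarrow> nat \<Rightarrow> bool list" where
  "padding r j = blocks (replicate j (r, r))"

text \<open>In the natural numbers, \<open>(a - b) + (b - a)\<close> is the absolute difference.\<close>

definition l1_dist :: "'k list \<Rightarrow> ('k \<Rightarrow> nat) \<Rightarrow> ('k \<Rightarrow> nat) \<Rightarrow> nat" where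
  "l1_dist ks x y = (\<Sum>k\<leftarrow>ks. (x k - y k) + (y k - x k))"

lemma length_padding: "length (padding r j) = 2 * r * j"
  by (induction j) (auto simp: padding_def)

lemma length_vec_word:
  "\<forall>k\<in>set ks. x k \<le> T \<Longrightarrow> length (vec_word M T ks x) = length ks * (2 * M + T)"
  by (induction ks) (auto simp: vec_word_def)

text \<open>Passing from \<open>x k\<close> to \<open>y k\<close> turns \<open>|x k - y k|\<close>
  letters next to one boundary into the other letter. The rates \<open>a\<close> and
  \<open>b\<close> per letter are parameters, since both pure replacement (0 and 1) and pure
  insertion and deletion (2 and 0) are wanted.\<close>

lemma edits_vec_word:
  assumes sw: "\<And>s. edits (a * s) (b * s) (replicate s True) (replicate s False)"
    "\<And>s. edits (a * s) (b * s) (replicate s False) (replicate s True)"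
    and "\<forall>k\<in>set ks. x k \<le> T" "\<forall>k\<in>set ks. y k \<le> T"
  shows "edits (a * l1_dist ks x y) (b * l1_dist ks x y) (vec_word M T ks x) (vec_word M T ks y)"
  using assms(3,4)
proof (induction ks)
  case Nil
  show ?case by (simp add: vec_word_def l1_dist_def edits_refl)
next
  case (Cons k ks)
  let ?d = "(x k - y k) + (y k - x k)"
  have "edits (a * ?d) (b * ?d) (block (M + x k, M + (T - x k))) (block (M + y k, M + (T - y k)))"
  proof (cases "x k \<le> y k")
    case True
    then have eq: "block (M + x k, M + (T - x k)) = replicate (M + x k) True @
        replicate (y k - x k) False @ replicate (M + (T - y k)) False"
      "block (M + y k, M + (T - y k)) = replicate (M + x k) True @
        replicate (y k - x k) True @ replicate (M + (T - y k)) False"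
      using Cons.prems by (auto simp: block_def simp flip: replicate_add append_assoc)
    show ?thesis unfolding eq using True sw(2)[of "y k - x k"] by (intro edits_context) simp
  next
    case False
    then have eq: "block (M + x k, M + (T - x k)) = replicate (M + y k) True @
        replicate (x k - y k) True @ replicate (M + (T - x k)) False"
      "block (M + y k, M + (T - y k)) = replicate (M + y k) True @
        replicate (x k - y k) False @ replicate (M + (T - x k)) False"
      using Cons.prems by (auto simp: block_def simp flip: replicate_add append_assoc)
    show ?thesis unfolding eq using False sw(1)[of "x k - y k"] by (intro edits_context) simp
  qed
  from edits_append[OF this Cons.IH] Cons.prems show ?case
    by (simp add: vec_word_def l1_dist_def algebra_simps)
qed

lemma edits_replicate_replace: "edits 0 s (replicate s a) (replicate s b)"
proof (induction s)
  case (Suc s)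
  have "edits 0 1 [a] [b]" using edits_replace[OF edits_refl, of "[]" a "[]" b] by simp
  from edits_append[OF this Suc] show ?case by simp
qed (simp add: edits_refl)

lemma edits_replicate_insert_delete: "edits (2 * s) 0 (replicate s a) (replicate s b)"
proof (induction s)
  case (Suc s)
  have "edits 1 0 [a] [a, b]" using edits_insert[OF edits_refl, of "[a]" "[]" b] by simp
  then have "edits 2 0 [a] [b]" using edits_delete[of 1 0 "[a]" "[]" a "[b]"]
    by (simp add: numeral_2_eq_2)
  from edits_append[OF this Suc] show ?case by simp
qed (simp add: edits_refl)

text \<open>If \<open>w\<close> misses at least \<open>M\<close> letters, the bound on
  \<open>l1_dist\<close> suffices. Otherwise \<open>w\<close> has the block structure of both words,
  with the same run lengths by \<open>blocks_inject\<close>. Each run is at most the shorter of the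
  two matching runs, and
  \<open>min (x k) (y k) + min (T - x k) (T - y k) = T - |x k - y k|\<close>.\<close>

lemma length_common_subseq_vec_word:
  assumes bd: "\<forall>k\<in>set ks. x k \<le> T" "\<forall>k\<in>set ks. y k \<le> T"
    and M: "l1_dist ks x y \<le> M" "M \<le> r"
    and w: "subseq w (vec_word M T ks x @ padding r j)" "subseq w (vec_word M T ks y @ padding r j)"
  shows "length w + l1_dist ks x y \<le> length (vec_word M T ks x @ padding r j)"
proof (cases "length (vec_word M T ks x @ padding r j) < length w + M")
  case False
  with M show ?thesis by linarith
next
  case True
  define rs where "rs z = map (\<lambda>k. (M + z k, M + (T - z k))) ks @ replicate j (r, r)"
    for z :: "'a \<Rightarrow> nat"
  have rs: "blocks (rs z) = vec_word M T ks z @ padding r j" for z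
    by (simp add: rs_def vec_word_def padding_def)
  have ge: "\<forall>p\<in>set (rs z). M \<le> fst p \<and> M \<le> snd p" for z
    using M(2) by (auto simp: rs_def)
  let ?P = "\<lambda>c p. 0 < fst c \<and> 0 < snd c \<and> fst c \<le> fst p \<and> snd c \<le> snd (p :: nat \<times> nat)"
  obtain cs where cs: "w = blocks cs" "list_all2 ?P cs (rs x)"
    using subseq_blocks[OF _ ge[of x]] w(1) True unfolding rs by blast
  have "length (blocks (rs y)) = length (blocks (rs x))"
    using bd by (simp add: rs length_vec_word)
  then obtain ds where ds: "w = blocks ds" "list_all2 ?P ds (rs y)"
    using subseq_blocks[OF _ ge[of y]] w(2) True unfolding rs by (metis (no_types, lifting))
  have pos: "\<forall>c\<in>set es. 0 < fst c \<and> 0 < snd c" if "list_all2 ?P es ps" for es ps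
    using that by (induction rule: list_all2_induct) auto
  have "\<forall>c\<in>set cs. 0 < fst c \<and> 0 < snd c" "\<forall>c\<in>set ds. 0 < fst c \<and> 0 < snd c"
    using pos[OF cs(2)] pos[OF ds(2)] by blast+
  then have "cs = ds" using cs(1) ds(1) by (auto intro: blocks_inject)
  then have "list_all2 ?P cs (rs y)" using ds by simp
  from cs(2) this have "(\<Sum>c\<leftarrow>cs. fst c + snd c) + l1_dist ks x y \<le> (\<Sum>p\<leftarrow>rs x. fst p + snd p)"
    unfolding rs_def using bd
  proof (induction ks arbitrary: cs)
    case Nil
    from Nil(1) have "list_all2 ?P cs (replicate j (r, r))" by simp
    then have "(\<Sum>c\<leftarrow>cs. fst c + snd c) \<le> (\<Sum>p\<leftarrow>replicate j (r, r). fst p + snd p)"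
      by (induction rule: list_all2_induct) auto
    then show ?case by (simp add: l1_dist_def)
  next
    case (Cons k ks)
    then obtain c cs' where c: "cs = c # cs'" by (auto simp: list_all2_Cons2)
    have "(\<Sum>c\<leftarrow>cs'. fst c + snd c) + l1_dist ks x y \<le>
      (\<Sum>p\<leftarrow>map (\<lambda>k. (M + x k, M + (T - x k))) ks @ replicate j (r, r). fst p + snd p)"
      using Cons.prems c by (intro Cons.IH) auto
    then show ?case using Cons.prems c by (auto simp: l1_dist_def)
  qed
  then show ?thesis by (simp add: cs(1) length_blocks flip: rs)
qed

text \<open>One unit of \<open>l1_dist\<close> costs \<theta> by replacement and
  \<open>2 * \<gamma>\<close> by insertion and deletion; the bound through common subsequences shows
  that no mixture is cheaper.\<close>

lemma lev_vec_word:
  assumes pos: "\<gamma> > 0" "\<theta> > 0"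
    and bd: "\<forall>k\<in>set ks. x k \<le> T" "\<forall>k\<in>set ks. y k \<le> T"
    and M: "l1_dist ks x y \<le> M" "M \<le> r"
  shows "lev \<gamma> \<theta> (vec_word M T ks x @ padding r j) (vec_word M T ks y @ padding r j) =
    min \<theta> (2 * \<gamma>) * real (l1_dist ks x y)"
proof (rule antisym)
  let ?d = "l1_dist ks x y"
  have "edits (0 * ?d) (1 * ?d) (vec_word M T ks x) (vec_word M T ks y)"
    using bd edits_replicate_replace by (intro edits_vec_word) auto
  from edits_context[OF this, of "[]"]
  have 1: "edits 0 ?d (vec_word M T ks x @ padding r j) (vec_word M T ks y @ padding r j)" by simp
  have "edits (2 * ?d) (0 * ?d) (vec_word M T ks x) (vec_word M T ks y)"
    using bd edits_replicate_insert_delete by (intro edits_vec_word) auto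
  from edits_context[OF this, of "[]"]
  have 2: "edits (2 * ?d) 0 (vec_word M T ks x @ padding r j) (vec_word M T ks y @ padding r j)"
    by simp
  show "lev \<gamma> \<theta> (vec_word M T ks x @ padding r j) (vec_word M T ks y @ padding r j)
      \<le> min \<theta> (2 * \<gamma>) * real ?d"
    using lev_le[OF pos 1] lev_le[OF pos 2] by (simp add: min_def)
  show "min \<theta> (2 * \<gamma>) * real ?d
      \<le> lev \<gamma> \<theta> (vec_word M T ks x @ padding r j) (vec_word M T ks y @ padding r j)"
    using length_common_subseq_vec_word[OF bd M] bd
    by (intro lev_ge_common_subseq pos) (simp_all add: length_vec_word)
qed

lemma padding_add: "padding r (i + j) = padding r i @ padding r j"
  by (simp add: padding_def replicate_add)

text \<open>Each block of the padding contains both letters and so supplies one letter of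
  \<open>w\<close>.\<close>

lemma subseq_padding: "r \<ge> 1 \<Longrightarrow> length w \<le> j \<Longrightarrow> subseq w (padding r j)"
proof (induction w arbitrary: j)
  case (Cons a w)
  then obtain i where i: "j = Suc i" "length w \<le> i" by (cases j) auto
  have "subseq [a] (block (r, r))"
    using Cons.prems(1) by (cases a) (auto simp: subseq_singleton_left block_def)
  from list_emb_append_mono[OF this Cons.IH[OF Cons.prems(1) i(2)]] show ?case
    by (simp add: i padding_def)
qed auto

section \<open>Isometry groups\<close>

lemma carrier_isom_group:
  "carrier (isom_group d L) = {\<phi> \<in> Bij L. \<forall>u\<in>L. \<forall>v\<in>L. d (\<phi> u) (\<phi> v) = d u v}"
  by (simp add: isom_group_def)

lemma mult_isom_group:
  assumes "\<phi> \<in> carrier (isom_group d L)" "\<psi> \<in> carrier (isom_group d L)"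
  shows "\<phi> \<otimes>\<^bsub>isom_group d L\<^esub> \<psi> = compose L \<phi> \<psi>"
  using assms by (simp add: isom_group_def BijGroup_def)

lemma isom_groupI:
  assumes "\<phi> \<in> extensional L" "\<phi> ` L = L" "inj_on \<phi> L"
    "\<And>u v. u \<in> L \<Longrightarrow> v \<in> L \<Longrightarrow> d (\<phi> u) (\<phi> v) = d u v"
  shows "\<phi> \<in> carrier (isom_group d L)"
  using assms by (auto simp: carrier_isom_group Bij_def bij_betw_def)

lemma isom_groupD:
  assumes "\<phi> \<in> carrier (isom_group d L)"
  shows "\<phi> \<in> extensional L" "\<phi> ` L = L" "inj_on \<phi> L"
    "\<And>u v. u \<in> L \<Longrightarrow> v \<in> L \<Longrightarrow> d (\<phi> u) (\<phi> v) = d u v"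
    "\<And>u. u \<in> L \<Longrightarrow> \<phi> u \<in> L"
  using assms by (auto simp: carrier_isom_group Bij_def bij_betw_def)

text \<open>The isomorphism is conjugation by \<open>f\<close>. As \<open>d\<close> and
  \<open>d'\<close> are arbitrary functions, injectivity of \<open>f\<close> does not follow from
  preservation of distances and is assumed.\<close>

lemma isom_group_iso:
  assumes f: "inj_on f X" "f ` X = Y"
    and d: "\<And>x y. x \<in> X \<Longrightarrow> y \<in> X \<Longrightarrow> d' (f x) (f y) = d x y"
  shows "isom_group d' Y \<cong> isom_group d X"
proof -
  define g where "g = inv_into X f"
  have g: "g y \<in> X" "f (g y) = y" if "y \<in> Y" for y
    using that f(2) by (auto simp: g_def inv_into_into f_inv_into_f)
  have gf [simp]: "g (f x) = x" if "x \<in> X" for x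
    using that f(1) by (simp add: g_def)
  have fY: "f x \<in> Y" if "x \<in> X" for x using that f(2) by blast
  define F where "F \<phi> = (\<lambda>x\<in>X. g (\<phi> (f x)))" for \<phi>
  have mem: "F \<phi> \<in> carrier (isom_group d X)" if \<phi>: "\<phi> \<in> carrier (isom_group d' Y)" for \<phi>
  proof (rule isom_groupI)
    note D = isom_groupD[OF \<phi>]
    show "F \<phi> \<in> extensional X" by (simp add: F_def)
    show "inj_on (F \<phi>) X"
      using D(3,5) f(1) g fY unfolding F_def inj_on_def restrict_def by metis
    show "d (F \<phi> u) (F \<phi> v) = d u v" if "u \<in> X" "v \<in> X" for u v
    proof -
      have "d (F \<phi> u) (F \<phi> v) = d' (\<phi> (f u)) (\<phi> (f v))"
        using that d[of "F \<phi> u" "F \<phi> v"] g D(5) fY by (simp add: F_def)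
      then show ?thesis using that D(4) d fY by simp
    qed
    have "x \<in> F \<phi> ` X" if "x \<in> X" for x
    proof -
      obtain y where y: "y \<in> Y" "f x = \<phi> y" using D(2) fY[OF \<open>x \<in> X\<close>] by blast
      then have "F \<phi> (g y) = x" using g \<open>x \<in> X\<close> by (simp add: F_def flip: y(2))
      then show ?thesis using g y by blast
    qed
    moreover have "F \<phi> x \<in> X" if "x \<in> X" for x using that g D(5) fY by (simp add: F_def)
    ultimately show "F \<phi> ` X = X" by blast
  qed
  have "F \<in> iso (isom_group d' Y) (isom_group d X)"
  proof (rule isoI)
    show "F \<in> hom (isom_group d' Y) (isom_group d X)"
    proof (rule homI)
      show "F \<phi> \<in> carrier (isom_group d X)" if "\<phi> \<in> carrier (isom_group d' Y)" for \<phi>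
        using mem that .
      fix \<phi> \<psi> assume *: "\<phi> \<in> carrier (isom_group d' Y)" "\<psi> \<in> carrier (isom_group d' Y)"
      have "F (compose Y \<phi> \<psi>) = compose X (F \<phi>) (F \<psi>)"
        using isom_groupD(5)[OF *(2)] g fY by (auto simp: F_def compose_def)
      then show "F (\<phi> \<otimes>\<^bsub>isom_group d' Y\<^esub> \<psi>) = F \<phi> \<otimes>\<^bsub>isom_group d X\<^esub> F \<psi>"
        using * mem by (simp add: mult_isom_group)
    qed
    show "bij_betw F (carrier (isom_group d' Y)) (carrier (isom_group d X))"
      unfolding bij_betw_def
    proof
      show "inj_on F (carrier (isom_group d' Y))"
      proof (rule inj_onI)
        fix \<phi> \<psi> assume *: "\<phi> \<in> carrier (isom_group d' Y)" "\<psi> \<in> carrier (isom_group d' Y)"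
          and eq: "F \<phi> = F \<psi>"
        show "\<phi> = \<psi>"
        proof (rule extensionalityI[OF isom_groupD(1)[OF *(1)] isom_groupD(1)[OF *(2)]])
          fix y assume y: "y \<in> Y"
          have "f (F \<phi> (g y)) = f (F \<psi> (g y))" using eq by simp
          then show "\<phi> y = \<psi> y"
            using y g isom_groupD(5)[OF *(1) y] isom_groupD(5)[OF *(2) y] by (simp add: F_def)
        qed
      qed
      have "\<psi> \<in> F ` carrier (isom_group d' Y)" if \<psi>: "\<psi> \<in> carrier (isom_group d X)" for \<psi>
      proof -
        note D = isom_groupD[OF \<psi>]
        define \<phi> where "\<phi> = (\<lambda>y\<in>Y. f (\<psi> (g y)))"
        have "\<phi> \<in> carrier (isom_group d' Y)"
        proof (rule isom_groupI)
          show "\<phi> \<in> extensional Y" by (simp add: \<phi>_def)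
          show "inj_on \<phi> Y"
            using D(3,5) f(1) g unfolding \<phi>_def inj_on_def restrict_def by metis
          show "d' (\<phi> u) (\<phi> v) = d' u v" if "u \<in> Y" "v \<in> Y" for u v
            using that D(4,5) g d[of "\<psi> (g u)" "\<psi> (g v)"] d[of "g u" "g v"] by (simp add: \<phi>_def)
          have "y \<in> \<phi> ` Y" if "y \<in> Y" for y
          proof -
            obtain x where x: "x \<in> X" "g y = \<psi> x" using D(2) g(1)[OF \<open>y \<in> Y\<close>] by blast
            then have "\<phi> (f x) = y" using g(2)[OF \<open>y \<in> Y\<close>] fY by (simp add: \<phi>_def)
            then show ?thesis using fY x by blast
          qed
          moreover have "\<phi> y \<in> Y" if "y \<in> Y" for y using that g D(5) fY by (simp add: \<phi>_def)
          ultimately show "\<phi> ` Y = Y" by blast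
        qed
        moreover have "F \<phi> = \<psi>"
        proof (rule extensionalityI[of _ X])
          show "F \<phi> \<in> extensional X" by (simp add: F_def)
          show "F \<phi> x = \<psi> x" if "x \<in> X" for x using that fY D(5) by (simp add: F_def \<phi>_def)
        qed (rule D(1))
        ultimately show ?thesis by blast
      qed
      then show "F ` carrier (isom_group d' Y) = carrier (isom_group d X)" using mem by blast
    qed
  qed
  then show ?thesis by (rule is_isoI)
qed

section \<open>Isometry groups as products\<close>

text \<open>An isometry restricts to each class by \<open>pres\<close> and is determined by these
  restrictions. Conversely any family of isometries of the classes can be glued, because by
  \<open>cross\<close> moving points inside their classes does not change distances between
  classes.\<close>

lemma isom_group_partition:
  fixes B :: "'k \<Rightarrow> 'a set"
  assumes disj: "\<And>k l. k \<noteq> l \<Longrightarrow> B k \<inter> B l = {}"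
    and pres: "\<And>\<phi> k u. \<phi> \<in> carrier (isom_group d (\<Union>k. B k)) \<Longrightarrow> u \<in> B k \<Longrightarrow> \<phi> u \<in> B k"
    and cross: "\<And>k l u v u' v'. k \<noteq> l \<Longrightarrow> u \<in> B k \<Longrightarrow> u' \<in> B k \<Longrightarrow> v \<in> B l \<Longrightarrow> v' \<in> B l \<Longrightarrow>
      d u v = d u' v'"
  shows "isom_group d (\<Union>k. B k) \<cong> product_group UNIV (\<lambda>k. isom_group d (B k))"
proof -
  let ?L = "\<Union>k. B k"
  let ?I = "isom_group d ?L" and ?P = "product_group UNIV (\<lambda>k. isom_group d (B k))"
  define F where "F \<phi> = (\<lambda>k. restrict \<phi> (B k))" for \<phi> :: "'a \<Rightarrow> 'a"
  have mem: "F \<phi> k \<in> carrier (isom_group d (B k))" if \<phi>: "\<phi> \<in> carrier ?I" for \<phi> k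
  proof (rule isom_groupI)
    note D = isom_groupD[OF \<phi>]
    show "F \<phi> k \<in> extensional (B k)" by (simp add: F_def)
    show "inj_on (F \<phi> k) (B k)"
      using D(3) by (auto simp: F_def intro: inj_on_subset)
    show "d (F \<phi> k u) (F \<phi> k v) = d u v" if "u \<in> B k" "v \<in> B k" for u v
      using that D(4) by (auto simp: F_def)
    \<comment> \<open>The preimage of \<open>v\<close> lies in some class \<open>B l\<close>, which
      \<phi> maps into itself; disjointness then gives \<open>l = k\<close>.\<close>
    have "v \<in> F \<phi> k ` B k" if v: "v \<in> B k" for v
    proof -
      have "v \<in> \<phi> ` ?L" unfolding D(2) using v by blast
      then obtain l u where u: "u \<in> B l" "v = \<phi> u" by blast
      then have "v \<in> B l" using pres[OF \<phi>] by blast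
      then have "l = k" using v disj by blast
      then show ?thesis using u by (auto simp: F_def)
    qed
    then show "F \<phi> k ` B k = B k" using pres[OF \<phi>] by (auto simp: F_def)
  qed
  have "F \<in> iso ?I ?P"
  proof (rule isoI)
    show "F \<in> hom ?I ?P"
    proof (rule homI)
      show "F \<phi> \<in> carrier ?P" if "\<phi> \<in> carrier ?I" for \<phi>
        using mem[OF that] by (simp add: PiE_UNIV_domain)
      fix \<phi> \<psi> assume *: "\<phi> \<in> carrier ?I" "\<psi> \<in> carrier ?I"
      have "F (compose ?L \<phi> \<psi>) k = compose (B k) (F \<phi> k) (F \<psi> k)" for k
        using pres[OF *(2)] by (auto simp: F_def compose_def restrict_def)
      then show "F (\<phi> \<otimes>\<^bsub>?I\<^esub> \<psi>) = F \<phi> \<otimes>\<^bsub>?P\<^esub> F \<psi>"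
        using * mem by (auto simp: mult_isom_group)
    qed
    show "bij_betw F (carrier ?I) (carrier ?P)"
      unfolding bij_betw_def
    proof
      show "inj_on F (carrier ?I)"
      proof (rule inj_onI)
        fix \<phi> \<psi> assume *: "\<phi> \<in> carrier ?I" "\<psi> \<in> carrier ?I" and eq: "F \<phi> = F \<psi>"
        show "\<phi> = \<psi>"
        proof (rule extensionalityI[OF isom_groupD(1)[OF *(1)] isom_groupD(1)[OF *(2)]])
          fix u assume "u \<in> ?L"
          then obtain k where "u \<in> B k" by blast
          then show "\<phi> u = \<psi> u" using fun_cong[OF fun_cong[OF eq], of k u] by (simp add: F_def)
        qed
      qed
      have "f \<in> F ` carrier ?I" if f: "f \<in> carrier ?P" for f
      proof -
        have fk: "f k \<in> carrier (isom_group d (B k))" for k using f by (auto simp: PiE_UNIV_domain)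
        note D = isom_groupD[OF fk]
        define b where "b u = (THE k. u \<in> B k)" for u
        have b: "b u = k" if "u \<in> B k" for u k
          unfolding b_def using that disj by (intro the_equality) blast+
        define \<phi> where "\<phi> = (\<lambda>u\<in>?L. f (b u) u)"
        have \<phi>: "\<phi> u = f k u" if "u \<in> B k" for u k
          using that b by (auto simp: \<phi>_def)
        have "\<phi> \<in> carrier ?I"
        proof (rule isom_groupI)
          show "\<phi> \<in> extensional ?L" by (simp add: \<phi>_def)
          show "d (\<phi> u) (\<phi> v) = d u v" if uv: "u \<in> ?L" "v \<in> ?L" for u v
          proof -
            obtain k l where kl: "u \<in> B k" "v \<in> B l" using uv by blast
            show ?thesis
            proof (cases "k = l")
              case True
              then show ?thesis using kl D(4) by (auto simp: \<phi>)
            next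
              case False
              then show ?thesis
                using cross[OF False D(5)[OF kl(1)] kl(1) D(5)[OF kl(2)] kl(2)] kl by (simp add: \<phi>)
            qed
          qed
          show "inj_on \<phi> ?L"
          proof (rule inj_onI)
            fix u v assume "u \<in> ?L" "v \<in> ?L" and eq: "\<phi> u = \<phi> v"
            then obtain k l where kl: "u \<in> B k" "v \<in> B l" by blast
            then have "f k u = f l v" using eq by (simp add: \<phi>)
            moreover from this have "k = l" using disj[of k l] D(5)[OF kl(1)] D(5)[OF kl(2)] by auto
            ultimately show "u = v" using kl inj_onD[OF D(3)] by simp
          qed
          have "\<phi> ` B k = B k" for k using D(2)[of k] \<phi> by (metis image_cong)
          then show "\<phi> ` ?L = ?L" unfolding image_UN by simp
        qed
        moreover have "F \<phi> = f"
        proof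
          fix k
          show "F \<phi> k = f k"
            by (rule extensionalityI[OF _ D(1)]) (auto simp: F_def \<phi>)
        qed
        ultimately show ?thesis by blast
      qed
      then show "F ` carrier ?I = carrier ?P" using mem by (auto simp: PiE_UNIV_domain)
    qed
  qed
  then show ?thesis by (rule is_isoI)
qed

text \<open>This separates the class of index 0, which will carry \<open>G\<close>, from the classes
  that carry \<open>H\<close>.\<close>

lemma product_group_nat_split:
  "product_group (UNIV :: nat set) K \<cong> K 0 \<times>\<times> product_group UNIV (\<lambda>k. K (Suc k))"
proof -
  define F where "F f = (f 0, \<lambda>k. f (Suc k))" for f :: "nat \<Rightarrow> 'a"
  let ?P = "product_group UNIV K" and ?Q = "K 0 \<times>\<times> product_group UNIV (\<lambda>k. K (Suc k))"
  have "F \<in> iso ?P ?Q"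
  proof (rule isoI)
    show "F \<in> hom ?P ?Q" by (rule homI) (auto simp: F_def PiE_UNIV_domain Pi_iff)
    have "bij_betw F (carrier ?P) (carrier ?Q)"
    proof (rule bij_betwI)
      show "F \<in> carrier ?P \<rightarrow> carrier ?Q" by (auto simp: F_def PiE_UNIV_domain Pi_iff)
      show "(\<lambda>(a, f). case_nat a f) \<in> carrier ?Q \<rightarrow> carrier ?P"
        by (auto simp: PiE_UNIV_domain Pi_iff split: nat.split)
      show "(\<lambda>(a, f). case_nat a f) (F f) = f" for f
        by (auto simp: F_def fun_eq_iff split: nat.split)
      show "F ((\<lambda>(a, f). case_nat a f) p) = p" for p
        by (cases p) (simp add: F_def)
    qed
    then show "bij_betw F (carrier ?P) (carrier ?Q)" .
  qed
  then show ?thesis by (rule is_isoI)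
qed

text \<open>Compare the images of an element of least length with two long elements.\<close>

lemma length_preserved:
  fixes len :: "'a \<Rightarrow> nat"
  assumes \<phi>: "\<phi> ` L = L"
    and dist: "\<And>u v. u \<in> L \<Longrightarrow> v \<in> L \<Longrightarrow>
      \<bar>int (len (\<phi> u)) - int (len (\<phi> v))\<bar> = \<bar>int (len u) - int (len v)\<bar>"
    and unbounded: "\<And>n. \<exists>u\<in>L. n \<le> len u"
    and u: "u \<in> L"
  shows "len (\<phi> u) = len u"
proof -
  obtain u0 where u0: "u0 \<in> L" "\<And>v. v \<in> L \<Longrightarrow> len u0 \<le> len v"
    using ex_has_least_nat[of "\<lambda>u. u \<in> L" u len] u by blast
  have "u0 \<in> \<phi> ` L" using \<phi> u0(1) by simp
  then obtain z where z: "z \<in> L" "\<phi> z = u0" by blast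
  obtain y where y: "y \<in> L" "2 * len (\<phi> u0) + 2 * len z + len u0 \<le> len y"
    using unbounded[of "2 * len (\<phi> u0) + 2 * len z + len u0"] by blast
  have mem: "\<phi> v \<in> L" if "v \<in> L" for v using imageI[OF that, of \<phi>] \<phi> by simp
  have "len (\<phi> u0) = len u0"
  proof -
    note le = u0(2)[OF mem[OF u0(1)]] u0(2)[OF mem[OF y(1)]] u0(2)[OF z(1)]
    \<comment> \<open>\<open>y\<close> is so long that \<open>\<phi> y\<close> cannot be shorter
      than \<open>\<phi> u0\<close>, and it is not shorter than \<open>u0\<close> by minimality, so
      the absolute values disappear. The first two equations give
      \<open>len (\<phi> u0) + len z = 2 * len u0\<close>, and the third then makes all these
      lengths equal.\<close>
    have "len (\<phi> y) + len u0 = len (\<phi> u0) + len y"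
      using dist[OF u0(1) y(1)] le y(2) by linarith
    moreover have "len (\<phi> y) + len z = len u0 + len y"
      using dist[OF z(1) y(1), unfolded z(2)] le y(2) by linarith
    moreover have "len (\<phi> u0) = len z"
      using dist[OF u0(1) z(1), unfolded z(2)] le by linarith
    ultimately show ?thesis by linarith
  qed
  \<comment> \<open>For arbitrary \<open>u\<close> both lengths are measured upwards from the least
    length.\<close>
  then show ?thesis
    using dist[OF u u0(1)] u0(2)[OF u] u0(2)[OF mem[OF u]] by linarith
qed

section \<open>Finite groups as isometry groups\<close>

text \<open>Embedding a finite group \<open>H\<close> with an injection \<open>F\<close> into the naturals: the points
  \<open>(True, g)\<close> become scaled unit vectors, and the coordinates of \<open>(False, h)\<close> are translates of
  \<open>F\<close>, so that the distance between \<open>(True, g)\<close> and \<open>(False, h)\<close> determines \<open>g\<inverse>h\<close>.\<close>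

definition group_vec ::
  "('h, 'n) monoid_scheme \<Rightarrow> ('h \<Rightarrow> nat) \<Rightarrow> nat \<Rightarrow> bool \<times> 'h \<Rightarrow> 'h \<Rightarrow> nat" where
  "group_vec H F T p k =
    (if fst p then if k = snd p then T else 0 else F (inv\<^bsub>H\<^esub> k \<otimes>\<^bsub>H\<^esub> snd p))"

definition group_dist ::
  "('h, 'n) monoid_scheme \<Rightarrow> ('h \<Rightarrow> nat) \<Rightarrow> nat \<Rightarrow> bool \<times> 'h \<Rightarrow> bool \<times> 'h \<Rightarrow> nat" where
  "group_dist H F T p q = (\<Sum>k\<in>carrier H.
    (group_vec H F T p k - group_vec H F T q k) + (group_vec H F T q k - group_vec H F T p k))"

context group
begin

section \<open>Distances between coded group elements\<close>

lemma sum_left_mult: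
  assumes "a \<in> carrier G"
  shows "(\<Sum>k\<in>carrier G. f (a \<otimes> k)) = (\<Sum>k\<in>carrier G. f k)"
  by (rule sum.reindex_bij_witness[where i = "\<lambda>k. inv a \<otimes> k" and j = "\<lambda>k. a \<otimes> k"])
    (use assms in \<open>auto simp: m_assoc[symmetric]\<close>)

text \<open>Translation by \<open>a\<close> only permutes the coordinates: coordinate
  \<open>a \<otimes> k\<close> of the translated point is coordinate \<open>k\<close> of the
  original one.\<close>

lemma group_dist_left_mult:
  assumes "a \<in> carrier G" "snd p \<in> carrier G" "snd q \<in> carrier G"
  shows "group_dist G F T (fst p, a \<otimes> snd p) (fst q, a \<otimes> snd q) = group_dist G F T p q"
proof -
  have "group_vec G F T (fst r, a \<otimes> snd r) (a \<otimes> k) = group_vec G F T r k"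
    if "snd r \<in> carrier G" "k \<in> carrier G" for r k
  proof -
    have "inv (a \<otimes> k) \<otimes> (a \<otimes> snd r) = inv k \<otimes> snd r"
      using assms that by (simp add: inv_mult_group m_assoc inv_solve_left')
    then show ?thesis using assms that by (simp add: group_vec_def)
  qed
  then show ?thesis
    unfolding group_dist_def
    by (subst sum_left_mult[OF assms(1), symmetric]) (use assms in \<open>auto intro!: sum.cong\<close>)
qed

lemma group_dist_True_True:
  assumes "finite (carrier G)" "g \<in> carrier G" "h \<in> carrier G" "g \<noteq> h"
  shows "group_dist G F T (True, g) (True, h) = 2 * T"
proof -
  have "group_dist G F T (True, g) (True, h) =
    (\<Sum>k\<in>carrier G. (if k = g then T else 0) + (if k = h then T else 0))"
    unfolding group_dist_def by (rule sum.cong) (use assms in \<open>auto simp: group_vec_def\<close>)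
  also have "\<dots> = 2 * T" using assms by (simp add: sum.distrib)
  finally show ?thesis .
qed

text \<open>Coordinate \<open>g\<close> contributes \<open>T - F (inv g \<otimes> h)\<close>, every
  other coordinate \<open>k\<close> contributes \<open>F (inv k \<otimes> h)\<close>. The additive
  form avoids truncated subtraction.\<close>

lemma group_dist_True_False:
  assumes "finite (carrier G)" "g \<in> carrier G" "h \<in> carrier G" "\<And>k. k \<in> carrier G \<Longrightarrow> F k \<le> T"
  shows "group_dist G F T (True, g) (False, h) + 2 * F (inv g \<otimes> h) =
    T + (\<Sum>k\<in>carrier G. F (inv k \<otimes> h))"
proof -
  have "group_dist G F T (True, g) (False, h) + 2 * F (inv g \<otimes> h) =
    (\<Sum>k\<in>carrier G. ((if k = g then T else 0) - F (inv k \<otimes> h)) +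
      (F (inv k \<otimes> h) - (if k = g then T else 0)) + (if k = g then 2 * F (inv g \<otimes> h) else 0))"
    unfolding group_dist_def using assms by (subst (2) sum.distrib) (simp add: group_vec_def)
  also have "\<dots> = (\<Sum>k\<in>carrier G. (if k = g then T else 0) + F (inv k \<otimes> h))"
    by (rule sum.cong) (use assms in auto)
  also have "\<dots> = T + (\<Sum>k\<in>carrier G. F (inv k \<otimes> h))"
    using assms by (simp add: sum.distrib)
  finally show ?thesis .
qed

lemma group_dist_commute: "group_dist G F T p q = group_dist G F T q p"
  unfolding group_dist_def by (rule sum.cong) auto

text \<open>As \<open>k\<close> runs through the group, so does \<open>inv k \<otimes> h\<close>;
  hence the coordinate sum of \<open>(False, h)\<close> does not depend on \<open>h\<close>.\<close>

lemma sum_inv_right_mult: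
  assumes "h \<in> carrier G"
  shows "(\<Sum>k\<in>carrier G. f (inv k \<otimes> h)) = (\<Sum>k\<in>carrier G. f k)"
  by (rule sum.reindex_bij_witness[where i = "\<lambda>k. h \<otimes> inv k" and j = "\<lambda>k. inv k \<otimes> h"])
    (use assms in \<open>auto simp: m_assoc[symmetric] inv_mult_group inv_solve_right'\<close>,
      use assms in \<open>simp add: m_assoc\<close>)

text \<open>This is the triangle inequality through the zero vector. The bound is below
  \<open>2 * T\<close> once \<open>T\<close> exceeds the sum of \<open>F\<close>.\<close>

lemma group_dist_False_False:
  assumes "g \<in> carrier G" "h \<in> carrier G"
  shows "group_dist G F T (False, g) (False, h) \<le> 2 * (\<Sum>k\<in>carrier G. F k)"
proof -
  have "group_dist G F T (False, g) (False, h) \<le>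
    (\<Sum>k\<in>carrier G. F (inv k \<otimes> g) + F (inv k \<otimes> h))"
    unfolding group_dist_def by (rule sum_mono) (simp add: group_vec_def)
  also have "\<dots> = 2 * (\<Sum>k\<in>carrier G. F k)"
    using sum_inv_right_mult[OF assms(1), of F] sum_inv_right_mult[OF assms(2), of F]
    by (simp add: sum.distrib)
  finally show ?thesis .
qed

lemma group_dist_le:
  assumes fin: "finite (carrier G)" and "snd p \<in> carrier G" "snd q \<in> carrier G"
    and T: "(\<Sum>k\<in>carrier G. F k) < T"
  shows "group_dist G F T p q \<le> 2 * T"
proof -
  have F: "F k \<le> T" if "k \<in> carrier G" for k
    using member_le_sum[of k "carrier G" F] that fin T by simp
  have TF: "group_dist G F T (True, g) (False, h) \<le> 2 * T"
    if "g \<in> carrier G" "h \<in> carrier G" for g h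
    using group_dist_True_False[of g h F T, OF fin that F] sum_inv_right_mult[OF that(2), of F] T
    by simp
  have FF: "group_dist G F T (False, g) (False, h) \<le> 2 * T"
    if "g \<in> carrier G" "h \<in> carrier G" for g h
    using group_dist_False_False[OF that, of F T] T by simp
  have TT: "group_dist G F T (True, g) (True, h) \<le> 2 * T"
    if "g \<in> carrier G" "h \<in> carrier G" for g h
    using group_dist_True_True[OF fin that, of F T]
    by (cases "g = h") (simp_all add: group_dist_def)
  obtain b g c h where "p = (b, g)" "q = (c, h)" by (metis surj_pair)
  then show ?thesis
    using assms TT[of g h] TF[of g h] TF[of h g] FF[of g h] group_dist_commute[of F T p q]
    by (cases b; cases c) simp_all
qed

lemma group_dist_eq_0:
  assumes fin: "finite (carrier G)" and p: "snd p \<in> carrier G" and q: "snd q \<in> carrier G"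
    and T: "(\<Sum>k\<in>carrier G. F k) < T" and inj: "inj_on F (carrier G)"
    and eq: "group_dist G F T p q = 0"
  shows "p = q"
proof -
  have F: "F k \<le> sum F (carrier G)" if "k \<in> carrier G" for k
    using member_le_sum[of k "carrier G" F] that fin by simp
  have TF: "group_dist G F T (True, g) (False, h) \<noteq> 0"
    if "g \<in> carrier G" "h \<in> carrier G" for g h
    \<comment> \<open>Distance 0 would force
      \<open>2 * F (inv g \<otimes> h) = T + sum F (carrier G)\<close>, whereas
      \<open>F (inv g \<otimes> h)\<close> is at most the sum and less than
      \<open>T\<close>.\<close>
    using group_dist_True_False[of g h F T, OF fin that] F[THEN le_less_trans, OF _ T]
      sum_inv_right_mult[OF that(2), of F] F[of "inv g \<otimes> h"] T that by fastforce
  have FF: "g = h" if "g \<in> carrier G" "h \<in> carrier G"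
    and "group_dist G F T (False, g) (False, h) = 0" for g h
  proof -
    \<comment> \<open>At distance 0 all coordinates agree; the one at \<open>\<one>\<close> already
      determines the group element.\<close>
    have "F (inv \<one> \<otimes> g) = F (inv \<one> \<otimes> h)"
      using that(3) one_closed fin unfolding group_dist_def group_vec_def
      by (intro antisym) (simp_all del: inv_one)
    then show ?thesis using inj_onD[OF inj] that by simp
  qed
  have TT: "g = h" if "g \<in> carrier G" "h \<in> carrier G"
    and "group_dist G F T (True, g) (True, h) = 0" for g h
    using group_dist_True_True[OF fin that(1,2), of F T] that(3) T by (cases "g = h") auto
  obtain b g c h where bc: "p = (b, g)" "q = (c, h)" by (metis surj_pair)
  show ?thesis
  proof (cases b; cases c)
  qed (use bc p q eq TT TF[of g h] TF[of h g] FF group_dist_commute[of F T p q] in simp_all)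
qed

section \<open>Recovering the group from the distances\<close>

text \<open>Distance \<open>2 * T\<close> occurs exactly between distinct \<open>True\<close>
  points, so isometries preserve the first component. The mixed distances determine
  \<open>inv g \<otimes> h\<close> by injectivity of \<open>F\<close>, which forces one and the same
  left translation on both kinds of points.\<close>

lemma isom_group_group_dist:
  assumes fin: "finite (carrier G)" and two: "a \<in> carrier G" "a \<noteq> \<one>"
    and inj: "inj_on F (carrier G)" and T: "(\<Sum>k\<in>carrier G. F k) < T"
    and c: "(c :: real) > 0"
  shows "isom_group (\<lambda>p q. c * real (group_dist G F T p q)) (UNIV \<times> carrier G) \<cong> G"
proof -
  let ?X = "UNIV \<times> carrier G :: (bool \<times> 'a) set"
  let ?\<delta> = "group_dist G F T"
  let ?I = "isom_group (\<lambda>p q. c * real (?\<delta> p q)) ?X"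
  have F: "F k \<le> T" if "k \<in> carrier G" for k
    using member_le_sum[of k "carrier G" F] that fin T by simp
  define act where "act a = (\<lambda>p\<in>?X. (fst p, a \<otimes> snd p))" for a
  have TF: "?\<delta> (True, g) (False, h) < 2 * T"
    "?\<delta> (True, g) (False, h) + 2 * F (inv g \<otimes> h) = T + sum F (carrier G)"
    if "g \<in> carrier G" "h \<in> carrier G" for g h
    using group_dist_True_False[of g h F T, OF fin that F] sum_inv_right_mult[OF that(2), of F] T by simp_all
  have fst_iff: "fst p \<longleftrightarrow> (\<exists>q\<in>?X. ?\<delta> p q = 2 * T)" if p: "p \<in> ?X" for p
  proof
    assume "fst p"
    then obtain g where g: "p = (True, g)" "g \<in> carrier G" using p by (cases p) auto
    \<comment> \<open>Nontriviality of the group enters here: a \<open>True\<close> point needs a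
      second one at distance \<open>2 * T\<close>.\<close>
    have "\<exists>h\<in>carrier G. g \<noteq> h" using two one_closed by metis
    then show "\<exists>q\<in>?X. ?\<delta> p q = 2 * T"
      using group_dist_True_True[OF fin g(2)] g(1) by blast
  next
    assume "\<exists>q\<in>?X. ?\<delta> p q = 2 * T"
    then obtain q where q: "q \<in> ?X" "?\<delta> p q = 2 * T" by blast
    show "fst p"
    proof (rule ccontr)
      assume "\<not> fst p"
      then obtain g where g: "p = (False, g)" "g \<in> carrier G" using p by (cases p) auto
      obtain b h where h: "q = (b, h)" "h \<in> carrier G" using q(1) by (cases q) auto
      have "?\<delta> p q < 2 * T"
        using group_dist_False_False[OF g(2) h(2), of F T] T TF(1)[OF h(2) g(2)] g h group_dist_commute[of F T p q]
        by (cases b) simp_all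
      then show False using q(2) by simp
    qed
  qed
  have mem: "act a \<in> carrier ?I" if a: "a \<in> carrier G" for a
  proof (rule isom_groupI)
    show "act a \<in> extensional ?X" by (simp add: act_def)
    show "inj_on (act a) ?X" using a by (auto simp: act_def inj_on_def)
    have "p \<in> act a ` ?X" if p: "p \<in> ?X" for p
    proof (rule image_eqI)
      show "p = act a (fst p, inv a \<otimes> snd p)"
        using a p by (auto simp: act_def m_assoc[symmetric])
    qed (use a p in auto)
    then show "act a ` ?X = ?X" using a by (auto simp: act_def)
    show "c * real (?\<delta> (act a p) (act a q)) = c * real (?\<delta> p q)" if "p \<in> ?X" "q \<in> ?X" for p q
      using that group_dist_left_mult[OF a, of p q F T] by (auto simp: act_def)
  qed
  have surj: "\<exists>a\<in>carrier G. \<phi> = act a" if \<phi>: "\<phi> \<in> carrier ?I" for \<phi>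
  proof -
    note D = isom_groupD[OF \<phi>]
    have \<delta>: "?\<delta> (\<phi> p) (\<phi> q) = ?\<delta> p q" if "p \<in> ?X" "q \<in> ?X" for p q
      using D(4)[OF that] c by simp
    have fst: "fst (\<phi> p) = fst p" if p: "p \<in> ?X" for p
    proof -
      have "(\<exists>q\<in>?X. ?\<delta> (\<phi> p) q = 2 * T) \<longleftrightarrow> (\<exists>q\<in>\<phi> ` ?X. ?\<delta> (\<phi> p) q = 2 * T)"
        by (simp only: D(2))
      also have "\<dots> \<longleftrightarrow> (\<exists>q\<in>?X. ?\<delta> p q = 2 * T)" using \<delta>[OF p] by auto
      finally show ?thesis using fst_iff[OF p] fst_iff[OF D(5)[OF p]] by blast
    qed
    define \<alpha> where "\<alpha> b g = snd (\<phi> (b, g))" for b g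
    have \<alpha>: "\<phi> (b, g) = (b, \<alpha> b g)" "\<alpha> b g \<in> carrier G" if "g \<in> carrier G" for b g
      using fst[of "(b, g)"] D(5)[of "(b, g)"] that by (auto simp: \<alpha>_def prod_eq_iff)
    have key: "inv (\<alpha> True g) \<otimes> \<alpha> False h = inv g \<otimes> h"
      if gh: "g \<in> carrier G" "h \<in> carrier G" for g h
    proof -
      have "F (inv (\<alpha> True g) \<otimes> \<alpha> False h) = F (inv g \<otimes> h)"
        using TF(2)[OF gh] TF(2)[OF \<alpha>(2)[OF gh(1), of True] \<alpha>(2)[OF gh(2), of False]]
          \<delta>[of "(True, g)" "(False, h)"] \<alpha>(1) gh by simp
      then show ?thesis using inj_onD[OF inj] \<alpha>(2) gh by simp
    qed
    \<comment> \<open>The case \<open>g = h\<close> of \<open>key\<close> identifies the two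
      actions; the case \<open>g = \<one>\<close> then exhibits left translation by
      \<open>\<alpha> True \<one>\<close>.\<close>
    have F_T: "\<alpha> False g = \<alpha> True g" if "g \<in> carrier G" for g
      using key[OF that that] \<alpha>(2)[OF that] that by (simp add: inv_solve_left')
    have mult: "\<alpha> True h = \<alpha> True \<one> \<otimes> h" if h: "h \<in> carrier G" for h
    proof -
      have "inv (\<alpha> True \<one>) \<otimes> \<alpha> True h = h" using key[OF one_closed h] F_T[OF h] h by simp
      then show ?thesis using \<alpha>(2)[OF one_closed] \<alpha>(2)[OF h] h by (metis inv_solve_left)
    qed
    have "\<phi> = act (\<alpha> True \<one>)"
    proof (rule extensionalityI[OF D(1)])
      show "act (\<alpha> True \<one>) \<in> extensional ?X" by (simp add: act_def)
      fix p assume "p \<in> ?X"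
      then obtain b h where p: "p = (b, h)" "h \<in> carrier G" by blast
      have "\<alpha> b h = \<alpha> True \<one> \<otimes> h" using mult[OF p(2)] F_T[OF p(2)] by (cases b) simp_all
      then show "\<phi> p = act (\<alpha> True \<one>) p" using \<alpha>(1)[OF p(2)] p by (simp add: act_def)
    qed
    then show ?thesis using \<alpha>(2) by blast
  qed
  have "act \<in> iso G ?I"
  proof (rule isoI)
    show "act \<in> hom G ?I"
    proof (rule homI)
      fix a b assume ab: "a \<in> carrier G" "b \<in> carrier G"
      then have "act (a \<otimes> b) = compose ?X (act a) (act b)"
        by (auto simp: act_def compose_def m_assoc)
      then show "act (a \<otimes> b) = act a \<otimes>\<^bsub>?I\<^esub> act b" using ab mem by (simp add: mult_isom_group)
    qed (rule mem)
    have "inj_on act (carrier G)"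
    proof (rule inj_onI)
      fix a b assume ab: "a \<in> carrier G" "b \<in> carrier G" and "act a = act b"
      then have "act a (True, \<one>) = act b (True, \<one>)" by simp
      then show "a = b" using ab by (simp add: act_def)
    qed
    then show "bij_betw act (carrier G) (carrier ?I)"
      unfolding bij_betw_def using mem surj by blast
  qed
  then show ?thesis using iso_sym is_isoI by blast
qed

text \<open>The trivial group is treated separately: its two coded points could be swapped by an
  isometry.\<close>

lemma isom_group_singleton:
  assumes "carrier G = {\<one>}"
  shows "isom_group d {x} \<cong> G"
proof -
  have "carrier (isom_group d {x}) = {\<lambda>y\<in>{x}. y}"
    by (auto simp: carrier_isom_group Bij_def bij_betw_def extensional_def fun_eq_iff)
  moreover have "group (isom_group d {x})" by (rule group_isom_group)
  ultimately have "\<one>\<^bsub>isom_group d {x}\<^esub> = (\<lambda>y\<in>{x}. y)"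
    using group.is_monoid monoid.one_closed by fastforce
  then have "(\<lambda>_. \<one>) \<in> iso (isom_group d {x}) G"
    using \<open>carrier (isom_group d {x}) = _\<close> assms by (auto simp: iso_def hom_def bij_betw_def)
  then show ?thesis by (rule is_isoI)
qed

section \<open>Realization by binary words\<close>

text \<open>The run length \<open>r\<close> stays free above \<open>r0\<close>, and \<open>j\<close>
  is arbitrary, so that the word sets for two groups can share one padding. The bound
  \<open>D\<close> depends on neither.\<close>

lemma ex_word_set:
  assumes fin: "finite (carrier G)" and pos: "\<gamma> > 0" "\<theta> > 0"
  obtains W :: "bool list set" and n D r0 where "W \<noteq> {}" "finite W" "\<And>w. w \<in> W \<Longrightarrow> length w = n"
    "\<And>r j. r0 \<le> r \<Longrightarrow> isom_group (lev \<gamma> \<theta>) ((\<lambda>w. w @ padding r j) ` W) \<cong> G"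
    "\<And>r j u v. r0 \<le> r \<Longrightarrow> u \<in> W \<Longrightarrow> v \<in> W \<Longrightarrow>
      lev \<gamma> \<theta> (u @ padding r j) (v @ padding r j) \<le> D"
proof (cases "carrier G = {\<one>}")
  case True
  have "lev \<gamma> \<theta> u u \<le> 0" for u :: "bool list"
    using lev_le[OF pos edits_refl[of u]] by simp
  then show ?thesis
    using that[of "{[]}" 0 0 0] by (simp add: isom_group_singleton[OF True])
next
  case False
  then obtain a where a: "a \<in> carrier G" "a \<noteq> \<one>" by blast
  obtain F :: "'a \<Rightarrow> nat" where F: "inj_on F (carrier G)"
    using finite_imp_inj_to_nat_seg[OF fin] by blast
  obtain ks where ks: "set ks = carrier G" "distinct ks"
    using finite_distinct_list[OF fin] by blast
  define T where "T = Suc (\<Sum>k\<in>carrier G. F k)"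
  have T: "(\<Sum>k\<in>carrier G. F k) < T" by (simp add: T_def)
  let ?X = "UNIV \<times> carrier G :: (bool \<times> 'a) set" and ?c = "min \<theta> (2 * \<gamma>)"
  \<comment> \<open>Runs of length at least \<open>2 * T\<close> meet the requirement of
    \<open>lev_vec_word\<close>, since \<open>group_dist_le\<close> bounds all distances by
    \<open>2 * T\<close>.\<close>
  define f where "f p = vec_word (2 * T) T ks (group_vec G F T p)" for p
  have c: "?c > 0" using pos by simp
  have vec_le: "\<forall>k\<in>set ks. group_vec G F T p k \<le> T" if "p \<in> ?X" for p
  proof
    fix k assume "k \<in> set ks"
    then have "inv k \<otimes> snd p \<in> carrier G" using that ks(1) by (simp add: mem_Times_iff)
    then have "F (inv k \<otimes> snd p) \<le> sum F (carrier G)" using fin by (intro member_le_sum) simp_all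
    then show "group_vec G F T p k \<le> T" using T by (simp add: group_vec_def)
  qed
  have l1: "l1_dist ks (group_vec G F T p) (group_vec G F T q) = group_dist G F T p q" for p q
    using ks by (simp add: l1_dist_def group_dist_def sum_list_distinct_conv_sum_set)
  have le: "group_dist G F T p q \<le> 2 * T" if "p \<in> ?X" "q \<in> ?X" for p q
    using that by (intro group_dist_le[OF fin _ _ T]) (simp_all add: mem_Times_iff)
  have lev: "lev \<gamma> \<theta> (f p @ padding r j) (f q @ padding r j) = ?c * real (group_dist G F T p q)"
    if "p \<in> ?X" "q \<in> ?X" "2 * T \<le> r" for p q r j
    unfolding f_def
    using lev_vec_word[OF pos vec_le[OF that(1)] vec_le[OF that(2)] _ that(3)] le[OF that(1,2)]
    by (simp add: l1)
  have inj: "inj_on f ?X"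
  proof (rule inj_onI)
    fix p q assume pq: "p \<in> ?X" "q \<in> ?X" and eq: "f p = f q"
    \<comment> \<open>With empty padding the distance formula applies to \<open>f p\<close> and
      \<open>f q\<close> themselves; equal words are at distance 0.\<close>
    have "lev \<gamma> \<theta> (f p @ padding (2 * T) 0) (f q @ padding (2 * T) 0) \<le> 0"
      unfolding eq using lev_le[OF pos edits_refl] by simp
    then have "group_dist G F T p q = 0"
      using lev[OF pq] c by (simp add: mult_le_0_iff)
    with pq show "p = q" by (intro group_dist_eq_0[OF fin _ _ T F]) (simp_all add: mem_Times_iff)
  qed
  show ?thesis
  proof (rule that[of "f ` ?X" "length ks * (2 * (2 * T) + T)" "2 * T" "?c * real (2 * T)"])
    show "f ` ?X \<noteq> {}" using a by blast
    show "finite (f ` ?X)" using fin by simp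
    show "length w = length ks * (2 * (2 * T) + T)" if "w \<in> f ` ?X" for w
      using that vec_le by (auto simp: f_def length_vec_word)
    fix r j assume r: "2 * T \<le> r"
    let ?g = "\<lambda>p. f p @ padding r j"
    have "isom_group (lev \<gamma> \<theta>) (?g ` ?X) \<cong>
        isom_group (\<lambda>p q. ?c * real (group_dist G F T p q)) ?X"
      by (rule isom_group_iso[where f = ?g]) (use inj lev r in \<open>auto simp: inj_on_def\<close>)
    moreover have "isom_group (\<lambda>p q. ?c * real (group_dist G F T p q)) ?X \<cong> G"
      by (rule isom_group_group_dist[OF fin a F T c])
    ultimately show "isom_group (lev \<gamma> \<theta>) ((\<lambda>w. w @ padding r j) ` f ` ?X) \<cong> G"
      unfolding image_image by (rule iso_trans)
    fix u v assume "u \<in> f ` ?X" "v \<in> f ` ?X"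
    then obtain p q where pq: "p \<in> ?X" "q \<in> ?X" "u = f p" "v = f q" by blast
    show "lev \<gamma> \<theta> (u @ padding r j) (v @ padding r j) \<le> ?c * real (2 * T)"
      unfolding pq(3,4) lev[OF pq(1,2) r] using le[OF pq(1,2)] c
      by (intro mult_left_mono) simp_all
  qed
qed

end

section \<open>The language\<close>

lemma lang_pow_padding: "lang_pow {padding r j} k = {padding r (j * k)}"
proof (induction k)
  case 0
  show ?case by (simp add: padding_def)
next
  case (Suc k)
  then show ?case by (simp add: lang_prod_def padding_add)
qed

text \<open>The single factor \<open>?P\<close> before the star shifts the exponents to
  \<open>Suc k\<close>, leaving the unpadded class to \<open>V\<close>.\<close>

lemma regular_padded:
  assumes "finite V" "finite W"
  shows "regular_language (V \<union> (\<Union>k. (\<lambda>w. w @ padding r (j * Suc k)) ` W))"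
proof -
  let ?P = "padding r j"
  have "lang_prod W (lang_prod {?P} (lang_star {?P})) = (\<Union>k. (\<lambda>w. w @ padding r (j * Suc k)) ` W)"
    by (auto simp: lang_prod_def lang_star_def lang_pow_padding padding_add)
  moreover have "regular_language (V \<union> lang_prod W (lang_prod {?P} (lang_star {?P})))"
    using assms by (intro regular_language.intros) auto
  ultimately show ?thesis by simp
qed

theorem theorem5:
  fixes G :: "('g, 'm) monoid_scheme" and H :: "('h, 'n) monoid_scheme"
    and \<gamma> \<theta> :: real
  assumes "group G" and "finite (carrier G)"
    and "group H" and "finite (carrier H)"
    and "\<gamma> > 0" and "\<theta> > 0"
  shows "\<exists>L :: bool list set. regular_language L \<and>
    isom_group (lev \<gamma> \<theta>) L \<cong> G \<times>\<times> product_group (UNIV :: nat set) (\<lambda>_. H)"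
proof -
  note pos = \<open>\<gamma> > 0\<close> \<open>\<theta> > 0\<close>
  let ?d = "lev \<gamma> \<theta> :: bool list \<Rightarrow> _"
  obtain V :: "bool list set" and nV DV rV where V: "V \<noteq> {}" "finite V" "\<And>w. w \<in> V \<Longrightarrow> length w = nV"
    "\<And>r j. rV \<le> r \<Longrightarrow> isom_group ?d ((\<lambda>w. w @ padding r j) ` V) \<cong> G"
    "\<And>r j u v. rV \<le> r \<Longrightarrow> u \<in> V \<Longrightarrow> v \<in> V \<Longrightarrow> ?d (u @ padding r j) (v @ padding r j) \<le> DV"
    by (rule group.ex_word_set[OF assms(1,2) pos]) (rule that)
  obtain W :: "bool list set" and nW DW rW where W: "W \<noteq> {}" "finite W" "\<And>w. w \<in> W \<Longrightarrow> length w = nW"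
    "\<And>r j. rW \<le> r \<Longrightarrow> isom_group ?d ((\<lambda>w. w @ padding r j) ` W) \<cong> H"
    "\<And>r j u v. rW \<le> r \<Longrightarrow> u \<in> W \<Longrightarrow> v \<in> W \<Longrightarrow> ?d (u @ padding r j) (v @ padding r j) \<le> DW"
    by (rule group.ex_word_set[OF assms(3,4) pos]) (rule that)
  \<comment> \<open>\<open>Suc\<close> makes \<open>r\<close> positive, as
    \<open>subseq_padding\<close> demands.\<close>
  define r where "r = Suc (max rV rW)"
  define D where "D = max DV DW"
  \<comment> \<open>Chosen so that \<open>gap\<close> insertions cost more than \<open>D\<close>,
    the bound on distances within a class.\<close>
  define gap where "gap = Suc (nat \<lceil>D / \<gamma>\<rceil>)"
  \<comment> \<open>The part \<open>nV + nW\<close> lets \<open>padding r j\<close> contain each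
    word of \<open>V\<close> and \<open>W\<close> as a subsequence; \<open>nV + gap\<close> ensures
    that lengths grow by at least \<open>gap\<close> from class to class, also from class 0 to class
    1.\<close>
  define j where "j = nV + nW + gap"
  define S where "S k = (if k = 0 then V else W)" for k :: nat
  define B where "B k = (\<lambda>w. w @ padding r (j * k)) ` S k" for k
  define len where "len k = (if k = 0 then nV else nW) + 2 * r * (j * k)" for k
  have r: "rV \<le> r" "rW \<le> r" "1 \<le> r" by (auto simp: r_def)
  have S_len: "length w = (if k = 0 then nV else nW)" if "w \<in> S k" for w k
    using that V(3) W(3) by (auto simp: S_def split: if_splits)
  have B_len: "length u = len k" if "u \<in> B k" for u k
    using that S_len by (auto simp: B_def len_def length_padding)
  have len_Suc: "len k + gap \<le> len (Suc k)" for k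
  proof -
    have "j \<le> 2 * r * j" using r by simp
    then show ?thesis by (auto simp: len_def j_def algebra_simps)
  qed
  have len_less: "len k + gap \<le> len l" if "k < l" for k l
    using that
  proof (induction l)
    case (Suc l)
    then show ?case using len_Suc[of l] by (cases "k = l") auto
  qed simp
  have "D / \<gamma> < real gap" unfolding gap_def by linarith
  then have gap: "D < \<gamma> * real gap" using pos by (simp add: pos_divide_less_eq mult.commute)
  have within: "?d u v \<le> D" if "u \<in> B k" "v \<in> B k" for u v k
    using that V(5)[OF r(1)] W(5)[OF r(2)]
    by (auto simp: B_def S_def D_def le_max_iff_disj split: if_splits)
  \<comment> \<open>With \<open>P = padding r j\<close>, the word \<open>u = w P^k\<close> embeds in
    \<open>P^(k+1)\<close> because \<open>w\<close> embeds in one \<open>P\<close>; and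
    \<open>v\<close> ends with \<open>P^(k+1)\<close>, since its class has a larger index.\<close>
  have subseq_B: "subseq u v" if "k < l" "u \<in> B k" "v \<in> B l" for u v k l
  proof -
    obtain w where w: "w \<in> S k" "u = w @ padding r (j * k)" using \<open>u \<in> B k\<close> by (auto simp: B_def)
    have "subseq w (padding r j)"
      using S_len[OF w(1)] r(3) by (intro subseq_padding) (auto simp: j_def)
    then have "subseq u (padding r j @ padding r (j * k))"
      unfolding w(2) by (intro list_emb_append_mono) simp_all
    moreover obtain i where "l = Suc k + i" using \<open>k < l\<close> less_imp_Suc_add by fastforce
    then have "j * l = j * i + (j + j * k)" by (simp add: algebra_simps)
    then have "padding r (j * l) = padding r (j * i) @ padding r j @ padding r (j * k)"
      by (simp only: padding_add)
    then obtain y where "v = y @ padding r j @ padding r (j * k)"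
      using \<open>v \<in> B l\<close> by (auto simp: B_def)
    ultimately show ?thesis by (simp add: list_emb_append2)
  qed
  have cross: "?d u v = \<gamma> * \<bar>real (len k) - real (len l)\<bar>"
    if "k \<noteq> l" "u \<in> B k" "v \<in> B l" for u v k l
    using lev_subseq[OF pos subseq_B[of k l u v]] lev_subseq[OF pos subseq_B[of l k v u]]
      that B_len by (cases "k < l") auto
  have cross_gt: "D < ?d u v" if "k \<noteq> l" "u \<in> B k" "v \<in> B l" for u v k l
  proof -
    have "real gap \<le> \<bar>real (len k) - real (len l)\<bar>"
      using that(1) len_less[of k l] len_less[of l k] by (cases "k < l") auto
    then have "\<gamma> * real gap \<le> \<gamma> * \<bar>real (len k) - real (len l)\<bar>" using pos by simp
    then show ?thesis using cross[OF that] gap by linarith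
  qed
  let ?L = "\<Union>k. B k"
  \<comment> \<open>The length difference is a function of the distance alone, with \<open>D\<close>
    as the threshold between equal and distinct classes; hence isometries preserve length
    differences.\<close>
  have len_diff: "real_of_int \<bar>int (length u) - int (length v)\<bar> =
      (if ?d u v \<le> D then 0 else ?d u v / \<gamma>)" if uv: "u \<in> ?L" "v \<in> ?L" for u v
  proof -
    obtain k l where kl: "u \<in> B k" "v \<in> B l" using uv by blast
    show ?thesis
    proof (cases "k = l")
      case True
      then show ?thesis using kl B_len within by auto
    next
      case False
      then show ?thesis
        using cross[OF False kl] cross_gt[OF False kl] B_len[OF kl(1)] B_len[OF kl(2)] pos by simp
    qed
  qed
  have len_inj: "k = l" if "len k = len l" for k l
    using that len_less[of k l] len_less[of l k] by (cases k l rule: linorder_cases) (auto simp: gap_def)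
  have B_ne: "B k \<noteq> {}" for k using V(1) W(1) by (simp add: B_def S_def)
  have pres: "\<phi> u \<in> B k" if \<phi>: "\<phi> \<in> carrier (isom_group ?d ?L)" and u: "u \<in> B k" for \<phi> u k
  proof -
    note I = isom_groupD[OF \<phi>]
    have uL: "u \<in> ?L" using u by blast
    have "length (\<phi> u) = length u"
    proof (rule length_preserved[OF I(2) _ _ uL])
      show "\<bar>int (length (\<phi> v)) - int (length (\<phi> w))\<bar> = \<bar>int (length v) - int (length w)\<bar>"
        if "v \<in> ?L" "w \<in> ?L" for v w
        using len_diff[OF that, folded I(4)[OF that]] len_diff[OF I(5)[OF that(1)] I(5)[OF that(2)]]
        by (metis of_int_eq_iff)
      fix n
      \<comment> \<open>Lengths grow with the class index, which gives the unboundedness required by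
        \<open>length_preserved\<close>.\<close>
      have "n \<le> len n"
      proof (induction n)
        case (Suc n)
        then show ?case using len_Suc[of n] by (simp add: gap_def)
      qed simp
      then show "\<exists>v\<in>?L. n \<le> length v" using B_ne[of n] B_len[of _ n] by fastforce
    qed
    moreover obtain l where l: "\<phi> u \<in> B l" using I(5)[OF uL] by blast
    ultimately have "len l = len k" using B_len[OF u] B_len[OF l] by simp
    then show ?thesis using l len_inj by blast
  qed
  have "isom_group ?d ?L \<cong> product_group UNIV (\<lambda>k. isom_group ?d (B k))"
  proof (rule isom_group_partition)
    show "B k \<inter> B l = {}" if "k \<noteq> l" for k l
      using B_len[of _ k] B_len[of _ l] len_inj that by fastforce
    show "\<phi> u \<in> B k" if "\<phi> \<in> carrier (isom_group ?d ?L)" "u \<in> B k" for \<phi> k u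
      using that by (rule pres)
    show "?d u v = ?d u' v'" if "k \<noteq> l" "u \<in> B k" "u' \<in> B k" "v \<in> B l" "v' \<in> B l" for k l u v u' v'
      using cross[OF that(1,2,4)] cross[OF that(1,3,5)] by simp
  qed
  also have "\<dots> \<cong> isom_group ?d (B 0) \<times>\<times> product_group UNIV (\<lambda>k. isom_group ?d (B (Suc k)))"
    by (rule product_group_nat_split)
  also have "\<dots> \<cong> G \<times>\<times> product_group (UNIV :: nat set) (\<lambda>_. H)"
  proof (rule group.DirProd_iso_trans[OF group_isom_group])
    show "isom_group ?d (B 0) \<cong> G" using V(4)[OF r(1), of "j * 0"] by (simp add: B_def S_def)
    show "product_group UNIV (\<lambda>k. isom_group ?d (B (Suc k))) \<cong> product_group (UNIV :: nat set) (\<lambda>_. H)"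
    proof (rule iso_product_groupI)
      show "isom_group ?d (B (Suc k)) \<cong> H" for k
        using W(4)[OF r(2), of "j * Suc k"] by (simp add: B_def S_def)
    qed (simp_all add: group_isom_group assms)
  qed
  finally have iso: "isom_group ?d ?L \<cong> G \<times>\<times> product_group (UNIV :: nat set) (\<lambda>_. H)" .
  have "B 0 = V" by (simp add: B_def S_def padding_def)
  moreover have "B (Suc k) = (\<lambda>w. w @ padding r (j * Suc k)) ` W" for k by (simp add: B_def S_def)
  moreover have "?L = B 0 \<union> (\<Union>k. B (Suc k))"
  proof (intro equalityI UN_least)
    show "B k \<subseteq> B 0 \<union> (\<Union>k. B (Suc k))" for k by (cases k) auto
  qed blast
  ultimately have "regular_language ?L" using regular_padded[OF V(2) W(2)] by simp
  with iso show ?thesis by blast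
qed

end
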